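(* Assume unit node costs. Let $\alpha\ge1$, $\beta\in(0,1]$ and let $\pi$ be an $(\alpha,\beta)$-approximate greedy policy. Let $\pi^*$ be any adaptive policy (in particular an optimal one). Then for all positive integers $l$ and $k$, $$f_{avg}(\pi_{[l]})\ \ge\ \big(1-e^{-\beta l/(\alpha k)}\big)\,f_{avg}(\pi^*_{[k]}).$$
   Context: Model (multi-seeding with intermediary constraints). $\mathcal G=(\mathcal V,\mathcal E)$ is a finite directed graph; for an arc $e=(u,v)$, $u$ is called the head node of $e$ and influence can pass from $u$ to $v$. Each arc $e$ has an influence probability $\bar w(e)\in[0,1]$ and each node $v$ has a reward $\mathbf r(v)\ge 0$; each seeding costs $1$. A seeding sequence is a finite sequence $y=(v_1,\dots,v_t)$ of nodes (repetitions allowed), $|y|=t$; $a@b$ denotes concatenation. A realization matrix is an array $M=(M(e,j))_{e\in\mathcal E,\,j\ge 1}$ with entries in $\{0,1\}$; $M(e,j)$ is the realization of arc $e$ the $j$-th time $e$ is observed. The random realization matrix $\mathbf M$ has independent entries $\mathbf M(e,j)\sim\mathrm{Bernoulli}(\bar w(e))$. Given $y=(v_1,\dots,v_t)$ and $M$, rounds $\tau=1,\dots,t$ are run on graphs $\mathcal G_\tau=(\mathcal V,\mathcal E_\tau)$, $\mathcal E_1=\mathcal E$: in round $\tau$ the seed $v_\tau$ is activated and an independent-cascade diffusion runs on $\mathcal G_\tau$: each node activated in round $\tau$ observes each of its outgoing arcs $e\in\mathcal E_\tau$ once in that round; if $e$ was observed $k$ times before, its realization is $M(e,k+1)$; if it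 equals $1$, the other endpoint of $e$ becomes activated in round $\tau$. After round $\tau$, for every node activated in round $\tau$ other than $v_\tau$ (an intermediary), all arcs pointing into that node are removed, giving $\mathcal E_{\tau+1}$. The partial matrix $M[y]$ agrees with $M$ on the entries observed during this process and equals "?" elsewhere. The objective $f(y,M)=\sum_{v\in S}\mathbf r(v)$, where $S$ is the set of nodes $v$ with $v\in y$ or with some arc $(u,v)$ having an observed entry equal to $1$. An observed history is a pair $(y,\tilde M_y)$ with $\tilde M_y$ a possible value of $\mathbf M[y]$. The expected marginal gain is $\Delta(v\mid y,\tilde M_y)=\mathbb E[f(y@(v),\mathbf M)\mid \mathbf M[y]=\tilde M_y]-f(y,\tilde M_y)$. An adaptive policy $\pi$ (possibly randomized) maps each observed history in a domain $dom(\pi)$ to a node; run under $M$ from the empty sequence, it seeds $v_t=\pi(y_{t-1},M[y_{t-1}])$ while $(y_{t-1},M[y_{t-1}])\in dom(\pi)$; $\pi(M)$ denotes the resulting complete seeding sequence and $f_{avg}(\pi)=\mathbb E[f(\pi(\mathbf M),\mathbf M)]$ (expectation over $\mathbf M$ and the policy's randomness). The level-$k$ truncation $\pi_{[k]}$ has domain $\{(y,\tilde M_y)\in dom(\pi):|y|<k\}$ and agrees with $\pi$ there. A policy $\pi$ is an $(\alpha,\beta)$-approximate greedy policy if for every observed history $(y,\tilde M_y)$ for which some $v$ has $\Delta(v\mid y,\tilde M_y)>0$, with probability at least $\beta$ it selects a node $v$ with $\Delta(v\mid y,\tilde M_y)\ge\frac1\alpha\max_{v'}\Delta(v'\mid y,\tilde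 M_y)$, and it terminates upon observing any history with $\Delta(v\mid y,\tilde M_y)=0$ for all $v\in\mathcal V$. *)

theory Defs
  imports "HOL-Probability.Probability"
begin

text \<open>Nodes are the elements of a finite type 'v (so the node set is UNIV).
  Arcs are pairs (u,v); u is the head node.  A realization matrix is a function
  on (arc, index) pairs; the index j (0-based) stands for the (j+1)-th observation.\<close>

type_synonym 'v rmat = "(('v \<times> 'v) \<times> nat) \<Rightarrow> bool"
type_synonym 'v pmat = "(('v \<times> 'v) \<times> nat) \<Rightarrow> bool option"
type_synonym 'v hist = "'v list \<times> 'v pmat"
type_synonym 'v policy = "'v hist set \<times> ('v hist \<Rightarrow> 'v pmf)"
type_synonym 'v state = "('v \<times> 'v) set \<times> (('v \<times> 'v) \<Rightarrow> nat) \<times> (('v \<times> 'v) \<times> nat) set"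

definition live_arcs :: "'v rmat \<Rightarrow> ('v \<times> 'v) set \<Rightarrow> (('v \<times> 'v) \<Rightarrow> nat) \<Rightarrow> ('v \<times> 'v) set" where
  "live_arcs M A c = {e \<in> A. M (e, c e)}"

definition activated :: "'v rmat \<Rightarrow> ('v \<times> 'v) set \<Rightarrow> (('v \<times> 'v) \<Rightarrow> nat) \<Rightarrow> 'v \<Rightarrow> 'v set" where
  "activated M A c s = {v. (s, v) \<in> (live_arcs M A c)\<^sup>*}"

definition observed_arcs :: "'v rmat \<Rightarrow> ('v \<times> 'v) set \<Rightarrow> (('v \<times> 'v) \<Rightarrow> nat) \<Rightarrow> 'v \<Rightarrow> ('v \<times> 'v) set" where
  "observed_arcs M A c s = {e \<in> A. fst e \<in> activated M A c s}"

text \<open>One round: state = (current arc set, observation counts, set of observed entries).\<close>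
definition diff_round :: "'v rmat \<Rightarrow> 'v \<Rightarrow> 'v state \<Rightarrow> 'v state" where
  "diff_round M s st = (case st of (A, c, Obs) \<Rightarrow>
     (let Act = activated M A c s; Ob = observed_arcs M A c s in
       (A - {e. snd e \<in> Act - {s}},
        \<lambda>e. if e \<in> Ob then Suc (c e) else c e,
        Obs \<union> {(e, c e) | e. e \<in> Ob})))"

definition run_state :: "('v \<times> 'v) set \<Rightarrow> 'v rmat \<Rightarrow> 'v list \<Rightarrow> 'v state" where
  "run_state E M y = fold (diff_round M) y (E, \<lambda>_. 0, {})"

definition partial :: "('v \<times> 'v) set \<Rightarrow> 'v rmat \<Rightarrow> 'v list \<Rightarrow> 'v pmat" where
  "partial E M y = (\<lambda>x. if x \<in> snd (snd (run_state E M y)) then Some (M x) else None)"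

definition seeded_set :: "('v \<times> 'v) set \<Rightarrow> 'v list \<Rightarrow> 'v pmat \<Rightarrow> 'v set" where
  "seeded_set E y P = set y \<union> {v. \<exists>u j. (u, v) \<in> E \<and> P ((u, v), j) = Some True}"

text \<open>Objective evaluated on an observed history (it only depends on the observed entries).\<close>
definition fval :: "('v \<times> 'v) set \<Rightarrow> ('v::finite \<Rightarrow> real) \<Rightarrow> 'v list \<Rightarrow> 'v pmat \<Rightarrow> real" where
  "fval E r y P = (\<Sum>v\<in>seeded_set E y P. r v)"

definition obj :: "('v \<times> 'v) set \<Rightarrow> ('v::finite \<Rightarrow> real) \<Rightarrow> 'v list \<Rightarrow> 'v rmat \<Rightarrow> real" where
  "obj E r y M = fval E r y (partial E M y)"

definition matrix_measure :: "(('v \<times> 'v) \<Rightarrow> real) \<Rightarrow> 'v rmat measure" where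
  "matrix_measure w = PiM UNIV (\<lambda>x. measure_pmf (bernoulli_pmf (w (fst x))))"

definition hist_event :: "('v \<times> 'v) set \<Rightarrow> 'v list \<Rightarrow> 'v pmat \<Rightarrow> 'v rmat set" where
  "hist_event E y P = {M. partial E M y = P}"

definition possible_hist :: "('v \<times> 'v) set \<Rightarrow> (('v \<times> 'v) \<Rightarrow> real) \<Rightarrow> 'v hist \<Rightarrow> bool" where
  "possible_hist E w h \<longleftrightarrow> measure (matrix_measure w) (hist_event E (fst h) (snd h)) > 0"

text \<open>Conditional expectation E[g(M) | M[y] = P] (elementary: the event has positive probability
  for possible histories).\<close>
definition cond_exp :: "('v \<times> 'v) set \<Rightarrow> (('v \<times> 'v) \<Rightarrow> real) \<Rightarrow> 'v list \<Rightarrow> 'v pmat \<Rightarrow> ('v rmat \<Rightarrow> real) \<Rightarrow> real" where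
  "cond_exp E w y P g =
     (\<integral>M. g M * indicator (hist_event E y P) M \<partial>matrix_measure w)
       / measure (matrix_measure w) (hist_event E y P)"

definition gain :: "('v \<times> 'v) set \<Rightarrow> ('v::finite \<Rightarrow> real) \<Rightarrow> (('v \<times> 'v) \<Rightarrow> real) \<Rightarrow> 'v \<Rightarrow> 'v hist \<Rightarrow> real" where
  "gain E r w v h = cond_exp E w (fst h) (snd h) (obj E r (fst h @ [v])) - fval E r (fst h) (snd h)"

definition approx_greedy ::
  "('v \<times> 'v) set \<Rightarrow> ('v::finite \<Rightarrow> real) \<Rightarrow> (('v \<times> 'v) \<Rightarrow> real) \<Rightarrow> real \<Rightarrow> real \<Rightarrow> 'v policy \<Rightarrow> bool" where
  "approx_greedy E r w \<alpha> \<beta> \<pi> \<longleftrightarrow>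
     (\<forall>h. possible_hist E w h \<longrightarrow>
        ((\<exists>v. gain E r w v h > 0) \<longrightarrow>
           h \<in> fst \<pi> \<and>
           measure_pmf.prob (snd \<pi> h)
             {v. gain E r w v h \<ge> (1 / \<alpha>) * Max (range (\<lambda>v'. gain E r w v' h))} \<ge> \<beta>) \<and>
        ((\<forall>v. gain E r w v h = 0) \<longrightarrow> h \<notin> fst \<pi>))"

definition trunc :: "'v policy \<Rightarrow> nat \<Rightarrow> 'v policy" where
  "trunc \<pi> k = ({h \<in> fst \<pi>. length (fst h) < k}, snd \<pi>)"

fun run_val :: "('v \<times> 'v) set \<Rightarrow> ('v::finite \<Rightarrow> real) \<Rightarrow> 'v policy \<Rightarrow> nat \<Rightarrow> 'v list \<Rightarrow> 'v rmat \<Rightarrow> real" where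
  "run_val E r \<pi> 0 y M = obj E r y M"
| "run_val E r \<pi> (Suc n) y M =
     (if (y, partial E M y) \<in> fst \<pi>
      then measure_pmf.expectation (snd \<pi> (y, partial E M y)) (\<lambda>v. run_val E r \<pi> n (y @ [v]) M)
      else obj E r y M)"

text \<open>f_avg(pi) = E[f(pi(M), M)]; for policies that terminate within n steps the n-step value
  is already the exact value, and the values are nondecreasing in n.\<close>
definition f_avg :: "('v \<times> 'v) set \<Rightarrow> ('v::finite \<Rightarrow> real) \<Rightarrow> (('v \<times> 'v) \<Rightarrow> real) \<Rightarrow> 'v policy \<Rightarrow> real" where
  "f_avg E r w \<pi> = (SUP n. \<integral>M. run_val E r \<pi> n [] M \<partial>matrix_measure w)"

end

theory Submission
  imports Defs
begin

text \<open>It suffices to show, for every \<open>i\<close>, that the value of \<open>\<pi>'\<close> truncated at level \<open>k\<close> is at most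
  the expectation, over the history \<open>h\<close> left by \<open>i\<close> rounds of \<open>\<pi>\<close>, of \<open>f(h) + k \<cdot> max\<^sub>v \<Delta>(v | h)\<close>;
  the bound then follows by contracting the gap by \<open>1 - \<beta> / (\<alpha> k)\<close> in each greedy round.

  Pathwise monotonicity of concatenation fails (extra activity may make a node an intermediary in
  a round in which it only hits the current seed), so \<open>\<pi>'\<close> is not appended to \<open>\<pi>\<close> but run from
  scratch, coupled with the run of \<open>\<pi>\<close> as follows.  A node is an intermediary at most once, so in
  the run of \<open>\<pi>'\<close> an arc out of an intermediary may use the realization \<open>M(e, 1)\<close>, while arcs out
  of the seed use fresh ones.  Let \<open>S\<close> be the set covered by \<open>h\<close>.  Every arc from \<open>S\<close> to its
  complement was present and observed at the first activation of its source node in \<open>h\<close>, and failed.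
  Hence a path along which \<open>\<pi>'\<close> reaches a node outside \<open>S\<close> avoids \<open>S\<close> after its seed; it uses only
  arcs that are still present after \<open>h\<close> and realizations independent of \<open>h\<close>.  So each round of
  \<open>\<pi>'\<close> adds at most \<open>max\<^sub>v \<Delta>(v | h)\<close> outside \<open>S\<close>.\<close>

section \<open>The process as a Markov chain\<close>

type_synonym 'v process_state = "('v \<times> 'v) set \<times> (('v \<times> 'v) \<Rightarrow> nat) \<times> 'v pmat"

definition reached :: "('v \<times> 'v) set \<Rightarrow> ('v \<times> 'v) set \<Rightarrow> 'v \<Rightarrow> 'v set" where
  "reached L A v = {x. (v, x) \<in> (L \<inter> A)\<^sup>*}"

text \<open>A round depends on the matrix only through \<open>L\<close>, the arcs whose next entry
  is 1. With \<open>L\<close> as an argument, the process becomes a chain driven by one random arc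
  set per round.\<close>

definition step :: "('v \<times> 'v) set \<Rightarrow> 'v \<Rightarrow> 'v process_state \<Rightarrow> 'v process_state" where
  "step L v s = (case s of (A, c, P) \<Rightarrow>
     (A - {e. snd e \<in> reached L A v - {v}},
      \<lambda>e. if e \<in> A \<and> fst e \<in> reached L A v then Suc (c e) else c e,
      \<lambda>x. if fst x \<in> A \<and> fst (fst x) \<in> reached L A v \<and> snd x = c (fst x)
          then Some (fst x \<in> L) else P x))"

definition hist_state :: "('v \<times> 'v) set \<Rightarrow> 'v rmat \<Rightarrow> 'v list \<Rightarrow> 'v process_state" where
  "hist_state E M y = (case run_state E M y of (A, c, Obs) \<Rightarrow> (A, c, partial E M y))"

abbreviation st_arcs :: "'v process_state \<Rightarrow> ('v \<times> 'v) set" where "st_arcs s \<equiv> fst s"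
abbreviation st_cnt :: "'v process_state \<Rightarrow> 'v \<times> 'v \<Rightarrow> nat" where "st_cnt s \<equiv> fst (snd s)"
abbreviation st_obs :: "'v process_state \<Rightarrow> 'v pmat" where "st_obs s \<equiv> snd (snd s)"

definition next_row :: "'v rmat \<Rightarrow> 'v process_state \<Rightarrow> ('v \<times> 'v) set" where
  "next_row M s = {e. M (e, st_cnt s e)}"

section \<open>Exploration from a seed\<close>

lemma start_in_reached: "v \<in> reached L A v"
  by (simp add: reached_def)

lemma reached_closed:
  assumes "u \<in> reached L A v" "(u, x) \<in> L" "(u, x) \<in> A"
  shows "x \<in> reached L A v"
  using assms unfolding reached_def by (auto intro: rtrancl.rtrancl_into_rtrancl)

lemma reached_induct [consumes 1, case_names start arc]:
  assumes "x \<in> reached L A v" "Q v"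
    and "\<And>u x. u \<in> reached L A v \<Longrightarrow> (u, x) \<in> L \<Longrightarrow> (u, x) \<in> A \<Longrightarrow> Q u \<Longrightarrow> Q x"
  shows "Q x"
proof -
  have "(v, x) \<in> (L \<inter> A)\<^sup>*" using assms(1) by (simp add: reached_def)
  then show ?thesis
    by (induction rule: rtrancl_induct) (use assms(2,3) in \<open>auto simp: reached_def\<close>)
qed

text \<open>The exploration queries only arcs out of nodes that it has already reached. These arcs
  therefore form a stopping set, on which the exchange arguments below rest.\<close>

lemma reached_cong:
  assumes "\<And>e. e \<in> A \<Longrightarrow> fst e \<in> reached L A v \<Longrightarrow> e \<in> L \<longleftrightarrow> e \<in> L'"
  shows "reached L' A v = reached L A v"
proof (intro equalityI subsetI)
  fix x assume "x \<in> reached L' A v"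
  then show "x \<in> reached L A v"
    by (induction rule: reached_induct) (use assms in \<open>auto simp: start_in_reached intro: reached_closed\<close>)
next
  fix x assume "x \<in> reached L A v"
  then have "x \<in> reached L A v \<and> x \<in> reached L' A v"
    by (induction rule: reached_induct) (use assms in \<open>auto simp: start_in_reached intro: reached_closed\<close>)
  then show "x \<in> reached L' A v" ..
qed

lemma step_cong:
  assumes "\<And>e. e \<in> st_arcs s \<Longrightarrow> fst e \<in> reached L (st_arcs s) v \<Longrightarrow> e \<in> L \<longleftrightarrow> e \<in> L'"
  shows "step L' v s = step L v s"
proof -
  obtain A c P where s: "s = (A, c, P)" by (cases s)
  have "reached L' A v = reached L A v" using assms by (intro reached_cong) (simp add: s)
  then show ?thesis using assms by (auto simp: s step_def fun_eq_iff)
qed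

lemma activated_eq_reached: "activated M A c v = reached {e. M (e, c e)} A v"
  unfolding activated_def reached_def live_arcs_def by (simp add: Int_def conj_commute)

section \<open>Histories as functions of the observed entries\<close>

lemma hist_state_Nil: "hist_state E M [] = (E, \<lambda>_. 0, \<lambda>_. None)"
  by (simp add: hist_state_def run_state_def partial_def fun_eq_iff)

lemma hist_state_snoc: "hist_state E M (y @ [v]) = step (next_row M (hist_state E M y)) v (hist_state E M y)"
proof -
  obtain A c Obs where r: "run_state E M y = (A, c, Obs)" by (cases "run_state E M y")
  have r2: "run_state E M (y @ [v]) = diff_round M v (A, c, Obs)"
    using r by (simp add: run_state_def)
  show ?thesis
    by (auto simp: hist_state_def partial_def r r2 diff_round_def step_def next_row_def Let_def
        activated_eq_reached observed_arcs_def fun_eq_iff)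
qed

lemma st_obs_hist_state: "st_obs (hist_state E M y) = partial E M y"
  by (simp add: hist_state_def split: prod.split)

lemma partial_agrees: "partial E M y x = Some b \<Longrightarrow> M x = b"
  by (auto simp: partial_def split: if_splits)

lemma partial_eq_agrees:
  assumes "partial E M' y = partial E M y" "partial E M y x \<noteq> None"
  shows "M' x = M x"
proof -
  obtain b where "partial E M y x = Some b" using assms(2) by blast
  then show ?thesis using assms(1) partial_agrees[of E M y x] partial_agrees[of E M' y x] by simp
qed

text \<open>Observations of an arc use consecutive indices, so the entry at the count is always
  unread. This is the source of the independence between a history and the next round.\<close>

lemma partial_dom_iff: "partial E M y (e, j) \<noteq> None \<longleftrightarrow> j < st_cnt (hist_state E M y) e"
proof (induction y rule: rev_induct)
  case Nil
  then show ?case by (simp add: hist_state_Nil flip: st_obs_hist_state)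
next
  case (snoc v y)
  then show ?case
    by (auto simp: hist_state_snoc step_def less_Suc_eq split: prod.splits simp flip: st_obs_hist_state)
qed

text \<open>A round reads nothing that it does not record, so the recorded entries alone also
  determine the remaining arcs and the counts.\<close>

lemma hist_state_eqI:
  assumes "\<And>x. partial E M y x \<noteq> None \<Longrightarrow> M' x = M x"
  shows "hist_state E M' y = hist_state E M y"
  using assms
proof (induction y rule: rev_induct)
  case Nil
  then show ?case by (simp add: hist_state_Nil)
next
  case (snoc v y)
  let ?s = "hist_state E M y"
  obtain A c P where s: "?s = (A, c, P)" by (cases ?s)
  have P: "P = partial E M y" using st_obs_hist_state[of E M y] s by simp
  have ext: "st_obs (hist_state E M (y @ [v])) =
      (\<lambda>x. if fst x \<in> A \<and> fst (fst x) \<in> reached (next_row M ?s) A v \<and> snd x = c (fst x)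
          then Some (fst x \<in> next_row M ?s) else P x)"
    unfolding hist_state_snoc step_def s by simp
  have agree: "M' x = M x" if "P x \<noteq> None \<or> fst x \<in> A \<and> fst (fst x) \<in> reached (next_row M ?s) A v \<and> snd x = c (fst x)" for x
    using that by (intro snoc.prems) (auto simp flip: st_obs_hist_state simp: ext)
  have IH: "hist_state E M' y = ?s" by (rule snoc.IH) (use agree P in auto)
  have "step (next_row M' ?s) v ?s = step (next_row M ?s) v ?s"
  proof (rule step_cong)
    fix e assume "e \<in> st_arcs ?s" "fst e \<in> reached (next_row M ?s) (st_arcs ?s) v"
    then show "e \<in> next_row M ?s \<longleftrightarrow> e \<in> next_row M' ?s" using agree[of "(e, c e)"] by (auto simp: s next_row_def)
  qed
  then show ?case by (simp add: hist_state_snoc IH)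
qed

lemma partial_mono:
  assumes "partial E M y x = Some b"
  shows "partial E M (y @ [v]) x = Some b"
proof -
  obtain A c P where s: "hist_state E M y = (A, c, P)" by (cases "hist_state E M y")
  have P: "P = partial E M y" using st_obs_hist_state[of E M y] s by simp
  \<comment> \<open>An observed index lies below the count, while \<open>step\<close> writes only at
    the count, so nothing is overwritten.\<close>
  have "snd x < c (fst x)"
    using partial_dom_iff[of E M y "fst x" "snd x"] assms by (simp add: s)
  then show ?thesis using assms P
    by (simp flip: st_obs_hist_state[of E M "y @ [v]"]) (simp add: hist_state_snoc s step_def)
qed

section \<open>Averaging over the live arcs of a round\<close>

text \<open>The law of one row of fresh realizations. It ranges over all pairs of nodes;
  \<open>step\<close> consults those in the current arc set.\<close>

definition live_weight :: "(('v::finite \<times> 'v) \<Rightarrow> real) \<Rightarrow> ('v \<times> 'v) set \<Rightarrow> real" where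
  "live_weight w L = (\<Prod>e\<in>UNIV. pmf (bernoulli_pmf (w e)) (e \<in> L))"

definition live_expectation :: "(('v::finite \<times> 'v) \<Rightarrow> real) \<Rightarrow> (('v \<times> 'v) set \<Rightarrow> real) \<Rightarrow> real" where
  "live_expectation w g = (\<Sum>L\<in>UNIV. live_weight w L * g L)"

lemma live_weight_nonneg: "0 \<le> live_weight w L"
  unfolding live_weight_def by (intro prod_nonneg) auto

text \<open>Expanding the product of \<open>p + (1 - p)\<close> over all pairs yields one summand
  per live set.\<close>

lemma live_weight_sum: "(\<Sum>L\<in>UNIV. live_weight w L) = 1"
proof -
  have bern: "pmf (bernoulli_pmf p) True + pmf (bernoulli_pmf p) False = 1" for p
    using sum_pmf_eq_1[of "{False, True}" "bernoulli_pmf p"] by (auto simp: add.commute)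
  have "1 = (\<Prod>e\<in>UNIV. pmf (bernoulli_pmf (w e)) True + pmf (bernoulli_pmf (w e)) False)"
    by (simp add: bern)
  also have "\<dots> = (\<Sum>L\<in>Pow UNIV. (\<Prod>e\<in>L. pmf (bernoulli_pmf (w e)) True)
      * (\<Prod>e\<in>UNIV - L. pmf (bernoulli_pmf (w e)) False))"
    by (rule prod_add) simp
  also have "\<dots> = (\<Sum>L\<in>UNIV. live_weight w L)"
  proof (rule sum.cong)
    fix L :: "('a \<times> 'a) set"
    have "live_weight w L = (\<Prod>e\<in>L. pmf (bernoulli_pmf (w e)) (e \<in> L))
        * (\<Prod>e\<in>UNIV - L. pmf (bernoulli_pmf (w e)) (e \<in> L))"
      unfolding live_weight_def by (subst prod.subset_diff[of L]) (simp_all add: mult.commute)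
    then show "(\<Prod>e\<in>L. pmf (bernoulli_pmf (w e)) True)
      * (\<Prod>e\<in>UNIV - L. pmf (bernoulli_pmf (w e)) False) = live_weight w L" by simp
  qed simp
  finally show ?thesis by simp
qed

lemma live_expectation_const: "live_expectation w (\<lambda>_. a) = a"
  by (simp add: live_expectation_def live_weight_sum flip: sum_distrib_right)

lemma live_expectation_cmult: "live_expectation w (\<lambda>L. a * g L) = a * live_expectation w g"
  by (simp add: live_expectation_def sum_distrib_left mult_ac)

lemma live_expectation_add: "live_expectation w (\<lambda>L. g L + h L) = live_expectation w g + live_expectation w h"
  by (simp add: live_expectation_def sum.distrib distrib_left)

lemma live_expectation_mono:
  assumes "\<And>L. 0 < live_weight w L \<Longrightarrow> g L \<le> h L"
  shows "live_expectation w g \<le> live_expectation w h"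
  unfolding live_expectation_def
proof (rule sum_mono)
  fix L
  show "live_weight w L * g L \<le> live_weight w L * h L"
    using assms[of L] live_weight_nonneg[of w L] by (cases "live_weight w L = 0") (auto intro: mult_left_mono)
qed

text \<open>\<open>X L\<close> is a stopping set of the exploration of \<open>L\<close>.  Exchanging \<open>L\<close> and \<open>K\<close> outside it is a
  weight-preserving involution on pairs.\<close>
lemma live_expectation_swap:
  assumes X: "\<And>L K. X ((L \<inter> X L) \<union> (K - X L)) = X L"
  shows "live_expectation w (\<lambda>L. live_expectation w (\<lambda>K. g L K)) =
    live_expectation w (\<lambda>L. live_expectation w (\<lambda>K. g ((L \<inter> X L) \<union> (K - X L)) ((K \<inter> X L) \<union> (L - X L))))"
proof -
  define sw where "sw = (\<lambda>(L, K). ((L \<inter> X L) \<union> (K - X L), (K \<inter> X L) \<union> (L - X L)))"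
  \<comment> \<open>By assumption the exchanged first component has the same stopping set, so a
    second exchange moves the same arcs back.\<close>
  have inv: "sw (sw p) = p" for p
    by (cases p) (auto simp: sw_def X)
  have live_weight: "live_weight w (fst (sw (L, K))) * live_weight w (snd (sw (L, K))) = live_weight w L * live_weight w K" for L K
    unfolding live_weight_def sw_def prod.distrib[symmetric]
  proof (rule prod.cong)
    fix e
    show "pmf (bernoulli_pmf (w e)) (e \<in> fst (case (L, K) of (L, K) \<Rightarrow> ((L \<inter> X L) \<union> (K - X L), (K \<inter> X L) \<union> (L - X L))))
        * pmf (bernoulli_pmf (w e)) (e \<in> snd (case (L, K) of (L, K) \<Rightarrow> ((L \<inter> X L) \<union> (K - X L), (K \<inter> X L) \<union> (L - X L))))
        = pmf (bernoulli_pmf (w e)) (e \<in> L) * pmf (bernoulli_pmf (w e)) (e \<in> K)"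
      by (cases "e \<in> X L") (simp_all add: mult.commute)
  qed simp
  have pairs: "live_expectation w (\<lambda>L. live_expectation w (\<lambda>K. h L K)) = (\<Sum>p\<in>UNIV. live_weight w (fst p) * live_weight w (snd p) * h (fst p) (snd p))" for h
    by (simp add: live_expectation_def sum_distrib_left sum.cartesian_product mult_ac case_prod_beta)
  have "live_expectation w (\<lambda>L. live_expectation w (\<lambda>K. g L K)) =
      (\<Sum>p\<in>UNIV. live_weight w (fst (sw p)) * live_weight w (snd (sw p)) * g (fst (sw p)) (snd (sw p)))"
    unfolding pairs by (rule sum.reindex_bij_witness[of _ sw sw]) (auto simp: inv)
  also have "\<dots> = live_expectation w (\<lambda>L. live_expectation w (\<lambda>K. g ((L \<inter> X L) \<union> (K - X L)) ((K \<inter> X L) \<union> (L - X L))))"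
    unfolding pairs by (rule sum.cong) (auto simp: live_weight, simp add: sw_def)
  finally show ?thesis .
qed

section \<open>Policies run with partly prescribed intermediary realizations\<close>

text \<open>\<open>\<kappa>\<close> prescribes realizations of some arcs; it is ignored for arcs out of the seed \<open>v\<close>.\<close>
definition override :: "('v \<times> 'v \<Rightarrow> bool option) \<Rightarrow> 'v \<Rightarrow> ('v \<times> 'v) set \<Rightarrow> ('v \<times> 'v) set" where
  "override \<kappa> v L = {e. if fst e = v \<or> \<kappa> e = None then e \<in> L else \<kappa> e = Some True}"

text \<open>Arcs not prescribed by \<open>\<kappa>\<close> are sampled afresh in each round, also when they were sampled
  before: an intermediary loses its incoming arcs, so no arc is used twice by a non-seed node.\<close>
fun policy_value :: "(('v::finite \<times> 'v) \<Rightarrow> real) \<Rightarrow> ('v \<times> 'v \<Rightarrow> bool option) \<Rightarrow> 'v policy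
    \<Rightarrow> ('v list \<Rightarrow> 'v process_state \<Rightarrow> real) \<Rightarrow> nat \<Rightarrow> 'v list \<Rightarrow> 'v process_state \<Rightarrow> real" where
  "policy_value w \<kappa> \<pi> g 0 y s = g y s"
| "policy_value w \<kappa> \<pi> g (Suc n) y s =
     (if (y, st_obs s) \<in> fst \<pi>
      then \<Sum>v\<in>UNIV. pmf (snd \<pi> (y, st_obs s)) v
             * live_expectation w (\<lambda>L. policy_value w \<kappa> \<pi> g n (y @ [v]) (step (override \<kappa> v L) v s))
      else g y s)"

text \<open>For a random \<open>K\<close>, this draws all intermediary realizations left open by
  \<open>\<kappa>\<close> in advance, once for the whole run.\<close>

definition fill :: "('v \<times> 'v \<Rightarrow> bool option) \<Rightarrow> ('v \<times> 'v) set \<Rightarrow> 'v \<times> 'v \<Rightarrow> bool option" where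
  "fill \<kappa> K e = (case \<kappa> e of None \<Rightarrow> Some (e \<in> K) | Some b \<Rightarrow> Some b)"

lemma override_None: "override (\<lambda>_. None) v L = L"
  by (simp add: override_def)

lemma st_arcs_step: "st_arcs (step L v s) = st_arcs s - {e. snd e \<in> reached L (st_arcs s) v - {v}}"
  by (simp add: step_def split: prod.split)

text \<open>A node of \<open>B\<close> has no incoming arcs left, so it can be active only as the
  seed, and then its prescriptions are ignored.\<close>

lemma policy_value_cong:
  assumes "\<And>e. fst e \<notin> B \<Longrightarrow> \<kappa> e = \<kappa>' e" and "\<And>e. e \<in> st_arcs s \<Longrightarrow> snd e \<notin> B"
  shows "policy_value w \<kappa> \<pi> g n y s = policy_value w \<kappa>' \<pi> g n y s"
  using assms(2)
proof (induction n arbitrary: y s)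
  case 0
  then show ?case by simp
next
  case (Suc n)
  have "step (override \<kappa>' v L) v s = step (override \<kappa> v L) v s" for v L
  proof (rule step_cong)
    fix e assume e: "e \<in> st_arcs s" and a: "fst e \<in> reached (override \<kappa> v L) (st_arcs s) v"
    have "fst e = v \<or> fst e \<notin> B"
      using a by (induction rule: reached_induct) (use Suc.prems in auto)
    then show "e \<in> override \<kappa> v L \<longleftrightarrow> e \<in> override \<kappa>' v L" using assms(1)[of e] by (auto simp: override_def)
  qed
  moreover have "policy_value w \<kappa> \<pi> g n (y @ [v]) (step (override \<kappa> v L) v s)
      = policy_value w \<kappa>' \<pi> g n (y @ [v]) (step (override \<kappa> v L) v s)" for v L
    by (rule Suc.IH) (use Suc.prems in \<open>auto simp: st_arcs_step\<close>)
  ultimately show ?case by simp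
qed

text \<open>Drawing intermediary realizations afresh or in advance gives the same law: an
  intermediary loses its incoming arcs, so the prescriptions of its outgoing arcs are consulted in
  one round only. Arcs out of seeds stay fresh in both versions.\<close>

lemma policy_value_reveal: "policy_value w \<kappa> \<pi> g n y s = live_expectation w (\<lambda>K. policy_value w (fill \<kappa> K) \<pi> g n y s)"
proof (induction n arbitrary: y s)
  case 0
  then show ?case by (simp add: live_expectation_const)
next
  case (Suc n)
  let ?V = "\<lambda>K v s'. policy_value w (fill \<kappa> K) \<pi> g n (y @ [v]) s'"
  have key: "live_expectation w (\<lambda>L. policy_value w \<kappa> \<pi> g n (y @ [v]) (step (override \<kappa> v L) v s)) =
      live_expectation w (\<lambda>K. live_expectation w (\<lambda>L. ?V K v (step (override (fill \<kappa> K) v L) v s)))" (is "?lhs = ?rhs") for v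
  proof -
    \<comment> \<open>\<open>T\<close> holds the arcs that ignore prescriptions in this round, and
      \<open>X L\<close> is the stopping set of the round.\<close>
    define T where "T = {e :: 'a \<times> 'a. fst e = v}"
    define X where "X L = {e :: 'a \<times> 'a. fst e \<in> reached (override \<kappa> v L) (st_arcs s) v}" for L
    have TX: "T \<subseteq> X L" for L by (auto simp: T_def X_def start_in_reached)
    have mixX: "e \<in> override \<kappa> v ((L \<inter> X L) \<union> (K - X L)) \<longleftrightarrow> e \<in> override \<kappa> v L" if "e \<in> X L" for e L K
      using that by (auto simp: override_def)
    have actX: "reached (override \<kappa> v ((L \<inter> X L) \<union> (K - X L))) (st_arcs s) v = reached (override \<kappa> v L) (st_arcs s) v" for L K
      by (rule reached_cong) (use mixX in \<open>auto simp: X_def\<close>)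
    have stepX: "step (override \<kappa> v ((L \<inter> X L) \<union> (K - X L))) v s = step (override \<kappa> v L) v s" for L K
      by (rule step_cong) (use mixX in \<open>auto simp: X_def\<close>)
    have T_sel: "((K \<inter> T \<union> (L - T)) \<inter> T) \<union> ((L \<inter> T \<union> (K - T)) - T) = K" for L K by blast
    have XX: "X ((L \<inter> X L) \<union> (K - X L)) = X L" for L K
      unfolding X_def[of "(L \<inter> X L) \<union> (K - X L)"] actX by (simp only: X_def)
    have "?lhs = live_expectation w (\<lambda>L. live_expectation w (\<lambda>K. ?V K v (step (override \<kappa> v L) v s)))"
      by (simp only: Suc.IH)
    \<comment> \<open>The round does not see \<open>L\<close> outside \<open>X L\<close>, so that
      part may be handed to the future in place of \<open>K\<close>.\<close>
    also have "\<dots> = live_expectation w (\<lambda>L. live_expectation w (\<lambda>K. ?V ((K \<inter> X L) \<union> (L - X L)) v (step (override \<kappa> v L) v s)))"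
      by (subst live_expectation_swap[where X = X]) (simp_all only: stepX XX)
    \<comment> \<open>On \<open>X L - T\<close> the future may also be given \<open>L\<close>
      instead of \<open>K\<close>: these arcs leave intermediaries of this round, which are no
      longer reachable.\<close>
    also have "\<dots> = live_expectation w (\<lambda>L. live_expectation w (\<lambda>K. ?V ((K \<inter> T) \<union> (L - T)) v (step (override \<kappa> v L) v s)))"
    proof -
      have "?V ((K \<inter> X L) \<union> (L - X L)) v (step (override \<kappa> v L) v s)
          = ?V ((K \<inter> T) \<union> (L - T)) v (step (override \<kappa> v L) v s)" for L K
        by (rule policy_value_cong[where B = "reached (override \<kappa> v L) (st_arcs s) v - {v}"])
          (auto simp: fill_def T_def X_def st_arcs_step start_in_reached split: option.split)
      then show ?thesis by simp
    qed
    \<comment> \<open>Exchanging the two rows off \<open>T\<close> renames the future's prescription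
      to \<open>K\<close>; the present round then reads \<open>K\<close> off \<open>T\<close> and
      the fresh \<open>L\<close> on \<open>T\<close>.\<close>
    also have "\<dots> = live_expectation w (\<lambda>L. live_expectation w (\<lambda>K. ?V K v (step (override \<kappa> v ((L \<inter> T) \<union> (K - T))) v s)))"
      by (subst live_expectation_swap[where X = "\<lambda>_. T"]) (simp_all only: T_sel)
    also have "\<dots> = live_expectation w (\<lambda>L. live_expectation w (\<lambda>K. ?V K v (step (override (fill \<kappa> K) v L) v s)))"
    proof -
      have "override \<kappa> v ((L \<inter> T) \<union> (K - T)) = override (fill \<kappa> K) v L" for L K
        by (auto simp: override_def fill_def T_def split: option.splits)
      then show ?thesis by simp
    qed
    also have "\<dots> = ?rhs"
      unfolding live_expectation_def sum_distrib_left by (subst sum.swap) (simp add: mult_ac)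
    finally show ?thesis .
  qed
  show ?case
  proof (cases "(y, st_obs s) \<in> fst \<pi>")
    case True
    then show ?thesis
      by (simp add: key) (simp add: live_expectation_def sum_distrib_left mult_ac, rule sum.swap)
  next
    case False
    then show ?thesis by (simp add: live_expectation_const)
  qed
qed


section \<open>Transfer to the matrix measure\<close>

definition history_cell :: "('v \<times> 'v) set \<Rightarrow> 'v list \<Rightarrow> 'v process_state \<Rightarrow> 'v rmat set" where
  "history_cell E y s = {M. hist_state E M y = s}"

lemma matrix_measure_prob_space: "prob_space (matrix_measure w)"
  unfolding matrix_measure_def by (intro prob_space_PiM prob_space_measure_pmf)

lemma space_matrix_measure: "space (matrix_measure w) = UNIV"
  by (simp add: matrix_measure_def space_PiM)

lemma cylinder:
  assumes "finite J"
  shows "{M. \<forall>x\<in>J. M x = m x} \<in> sets (matrix_measure w)" (is "?C \<in> _")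
    and "measure (matrix_measure w) {M. \<forall>x\<in>J. M x = m x} =
      (\<Prod>x\<in>J. pmf (bernoulli_pmf (w (fst x))) (m x))"
proof -
  interpret product_prob_space "\<lambda>x :: ('a \<times> 'a) \<times> nat. measure_pmf (bernoulli_pmf (w (fst x)))" UNIV
    by unfold_locales
  have C: "?C = {M \<in> space (matrix_measure w). \<forall>x\<in>J. M x \<in> {m x}}"
    by (simp add: space_matrix_measure)
  show "?C \<in> sets (matrix_measure w)"
    using assms sets_PiM_I[of J UNIV "\<lambda>x. {m x}" "\<lambda>x. measure_pmf (bernoulli_pmf (w (fst x)))"]
    by (simp add: matrix_measure_def prod_emb_def space_PiM vimage_def PiE_iff)
  show "measure (matrix_measure w) ?C = (\<Prod>x\<in>J. pmf (bernoulli_pmf (w (fst x))) (m x))"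
    unfolding C measure_def matrix_measure_def using assms
    by (subst emeasure_PiM_Collect)
      (auto simp: emeasure_pmf_single prod_ennreal intro!: enn2real_ennreal prod_nonneg)
qed

lemma finite_dom_partial: "finite {x. partial E (M :: ('v::finite) rmat) y x \<noteq> None}"
proof (rule finite_subset)
  show "{x. partial E M y x \<noteq> None} \<subseteq> (SIGMA e:UNIV. {..<st_cnt (hist_state E M y) e})"
    using partial_dom_iff[of E M y] by auto
qed auto

text \<open>Fixing the state amounts to fixing the finitely many observed entries, which makes the
  cell measurable with a product probability.\<close>

lemma history_cell_eq_cylinder:
  "history_cell E y (hist_state E M y) = {M'. \<forall>x\<in>{x. partial E M y x \<noteq> None}. M' x = M x}"
proof (intro equalityI subsetI)
  fix M' assume "M' \<in> history_cell E y (hist_state E M y)"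
  then have "partial E M' y = partial E M y" by (simp add: history_cell_def flip: st_obs_hist_state)
  then show "M' \<in> {M'. \<forall>x\<in>{x. partial E M y x \<noteq> None}. M' x = M x}"
    using partial_eq_agrees[of E M' y M] by blast
next
  fix M' assume "M' \<in> {M'. \<forall>x\<in>{x. partial E M y x \<noteq> None}. M' x = M x}"
  then have "hist_state E M' y = hist_state E M y" by (intro hist_state_eqI) blast
  then show "M' \<in> history_cell E y (hist_state E M y)" by (simp add: history_cell_def)
qed

lemma history_cell_sets: "history_cell E y s \<in> sets (matrix_measure (w :: ('v::finite \<times> 'v) \<Rightarrow> real))"
proof (cases "history_cell E y s = {}")
  case False
  then obtain M where "hist_state E M y = s" by (auto simp: history_cell_def)
  then show ?thesis
    using history_cell_eq_cylinder[of E y M] cylinder(1)[OF finite_dom_partial[of E M y]] by simp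
qed simp

lemma history_cell_snoc_subset:
  assumes "hist_state E M y = s"
  shows "history_cell E (y @ [v]) (step (next_row M s) v s) \<subseteq> history_cell E y s"
proof
  fix M' assume "M' \<in> history_cell E (y @ [v]) (step (next_row M s) v s)"
  then have "M' \<in> history_cell E (y @ [v]) (hist_state E M (y @ [v]))" using assms by (simp add: hist_state_snoc)
  then have "\<forall>x\<in>{x. partial E M (y @ [v]) x \<noteq> None}. M' x = M x"
    unfolding history_cell_eq_cylinder by simp
  then have "\<forall>x\<in>{x. partial E M y x \<noteq> None}. M' x = M x"
    using partial_mono[of E M y _ _ v] by blast
  then show "M' \<in> history_cell E y s" using assms history_cell_eq_cylinder[of E y M] by simp
qed

text \<open>The Markov property. The past fixes entries below the counts and the row fixes entries
  at the counts; these index sets are disjoint, so the cylinder probabilities multiply.\<close>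

lemma history_cell_inter_row:
  fixes w :: "('v::finite \<times> 'v) \<Rightarrow> real"
  assumes "history_cell E y s \<noteq> {}"
  shows "{M \<in> history_cell E y s. next_row M s = L} \<in> sets (matrix_measure w)"
    and "measure (matrix_measure w) {M \<in> history_cell E y s. next_row M s = L}
      = measure (matrix_measure w) (history_cell E y s) * live_weight w L"
    and "{M \<in> history_cell E y s. next_row M s = L} \<noteq> {}"
proof -
  obtain M where M: "hist_state E M y = s" using assms by (auto simp: history_cell_def)
  define J1 where "J1 = {x. partial E M y x \<noteq> None}"
  define J2 where "J2 = range (\<lambda>e. (e, st_cnt s e))"
  define m where "m x = (if x \<in> J2 then fst x \<in> L else M x)" for x
  have disj: "J1 \<inter> J2 = {}"
    using partial_dom_iff[of E M y] by (auto simp: J1_def J2_def M)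
  have fin: "finite J1" "finite J2"
    unfolding J1_def J2_def by (rule finite_dom_partial) simp
  have m1: "m x = M x" if "x \<in> J1" for x using that disj by (auto simp: m_def)
  have history_cell: "history_cell E y s = {M'. \<forall>x\<in>J1. M' x = m x}"
    using history_cell_eq_cylinder[of E y M] unfolding M J1_def[symmetric] by (auto simp: m1)
  have row: "next_row M' s = L \<longleftrightarrow> (\<forall>x\<in>J2. M' x = m x)" for M'
    by (auto simp: next_row_def J2_def m_def)
  have inter: "{M \<in> history_cell E y s. next_row M s = L} = {M'. \<forall>x\<in>J1 \<union> J2. M' x = m x}"
    unfolding history_cell row by auto
  show "{M \<in> history_cell E y s. next_row M s = L} \<in> sets (matrix_measure w)"
    unfolding inter using fin by (intro cylinder) simp
  show "{M \<in> history_cell E y s. next_row M s = L} \<noteq> {}" unfolding inter by blast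
  have "(\<Prod>x\<in>J2. pmf (bernoulli_pmf (w (fst x))) (m x)) = live_weight w L"
    unfolding J2_def live_weight_def by (subst prod.reindex) (auto simp: inj_on_def m_def J2_def)
  then show "measure (matrix_measure w) {M \<in> history_cell E y s. next_row M s = L}
      = measure (matrix_measure w) (history_cell E y s) * live_weight w L"
    unfolding inter using fin disj by (simp add: cylinder(2) history_cell prod.union_disjoint)
qed

text \<open>Unexplored arcs leave no trace in the state, so several rows may lead to the same one;
  the union collects them all.\<close>

lemma history_cell_split:
  fixes E :: "('v::finite \<times> 'v) set"
  assumes "hist_state E M0 y = s"
  shows "history_cell E (y @ [v]) (step L v s) = (\<Union>L'\<in>{L'. step L' v s = step L v s}. {M \<in> history_cell E y s. next_row M s = L'})"
    (is "?l = ?r")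
proof
  have "{M \<in> history_cell E y s. next_row M s = L} \<noteq> {}" by (rule history_cell_inter_row(3)) (use assms in \<open>auto simp: history_cell_def\<close>)
  then obtain M where "hist_state E M y = s" "next_row M s = L" by (auto simp: history_cell_def)
  then have "?l \<subseteq> history_cell E y s" using history_cell_snoc_subset[of E M y s v] by simp
  then show "?l \<subseteq> ?r" by (auto simp: history_cell_def hist_state_snoc subset_iff)
  show "?r \<subseteq> ?l" by (auto simp: history_cell_def hist_state_snoc)
qed

text \<open>The law of total expectation over one round. Writing integrals as measure times value
  includes cells of probability zero and carries integrability along.\<close>

lemma integral_step:
  fixes w :: "('v::finite \<times> 'v) \<Rightarrow> real"
  assumes "\<And>s'. has_bochner_integral (matrix_measure w)
      (\<lambda>M. h M * indicator (history_cell E (y @ [v]) s') M)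
      (measure (matrix_measure w) (history_cell E (y @ [v]) s') * G s')"
  shows "has_bochner_integral (matrix_measure w) (\<lambda>M. h M * indicator (history_cell E y s) M)
      (measure (matrix_measure w) (history_cell E y s) * live_expectation w (\<lambda>L. G (step L v s)))"
proof (cases "history_cell E y s = {}")
  case True
  then show ?thesis by (simp add: has_bochner_integral_zero)
next
  case False
  then obtain M0 where M0: "hist_state E M0 y = s" by (auto simp: history_cell_def)
  interpret prob_space "matrix_measure w" by (rule matrix_measure_prob_space)
  let ?S = "range (\<lambda>L. step L v s)"
  let ?p = "\<lambda>y s. measure (matrix_measure w) (history_cell E y s)"
  have sub: "history_cell E (y @ [v]) s' \<subseteq> history_cell E y s" if "s' \<in> ?S" for s'
    using that history_cell_split[OF M0] by force
  have ind: "indicator (history_cell E y s) M = (\<Sum>s'\<in>?S. indicator (history_cell E (y @ [v]) s') M :: real)" for M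
  proof (cases "M \<in> history_cell E y s")
    case True
    \<comment> \<open>Only the successor state that \<open>M\<close> itself produces
      contributes.\<close>
    have "(\<Sum>s'\<in>?S. indicator (history_cell E (y @ [v]) s') M :: real) = (\<Sum>s'\<in>{hist_state E M (y @ [v])}. 1)"
      using True by (intro sum.mono_neutral_cong_right) (auto simp: history_cell_def hist_state_snoc split: split_indicator)
    then show ?thesis using True by simp
  next
    case False
    then have "\<forall>s'\<in>?S. M \<notin> history_cell E (y @ [v]) s'" using sub by blast
    then have "(\<Sum>s'\<in>?S. indicator (history_cell E (y @ [v]) s') M :: real) = 0"
      by (intro sum.neutral) auto
    then show ?thesis using False by simp
  qed
  have p: "?p (y @ [v]) s' = (\<Sum>L | step L v s = s'. ?p y s * live_weight w L)" if "s' \<in> ?S" for s'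
  proof -
    obtain L where L: "s' = step L v s" using \<open>s' \<in> ?S\<close> by auto
    have "?p (y @ [v]) s' = (\<Sum>L' | step L' v s = s'.
        measure (matrix_measure w) {M \<in> history_cell E y s. next_row M s = L'})"
      unfolding L history_cell_split[OF M0]
      by (rule finite_measure_finite_Union)
        (use history_cell_inter_row(1)[OF False] in \<open>auto simp: disjoint_family_on_def\<close>)
    then show ?thesis by (simp add: history_cell_inter_row(2)[OF False])
  qed
  have "has_bochner_integral (matrix_measure w)
      (\<lambda>M. \<Sum>s'\<in>?S. h M * indicator (history_cell E (y @ [v]) s') M)
      (\<Sum>s'\<in>?S. ?p (y @ [v]) s' * G s')"
    by (intro has_bochner_integral_sum assms)
  moreover have "(\<Sum>s'\<in>?S. ?p (y @ [v]) s' * G s') = ?p y s * live_expectation w (\<lambda>L. G (step L v s))"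
  proof -
    have "(\<Sum>s'\<in>?S. ?p (y @ [v]) s' * G s')
        = (\<Sum>s'\<in>?S. \<Sum>L\<in>{L \<in> UNIV. step L v s = s'}. ?p y s * (live_weight w L * G (step L v s)))"
    proof (rule sum.cong)
      fix s' assume "s' \<in> ?S"
      then show "?p (y @ [v]) s' * G s' = (\<Sum>L\<in>{L \<in> UNIV. step L v s = s'}. ?p y s * (live_weight w L * G (step L v s)))"
        unfolding p[OF \<open>s' \<in> ?S\<close>] sum_distrib_right by (intro sum.cong) auto
    qed simp
    also have "\<dots> = (\<Sum>L\<in>UNIV. ?p y s * (live_weight w L * G (step L v s)))"
      by (rule sum.image_gen[symmetric]) simp
    finally show ?thesis by (simp add: live_expectation_def sum_distrib_left)
  qed
  ultimately show ?thesis by (simp add: ind sum_distrib_left)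
qed

lemma history_cell_const_integral:
  fixes w :: "('v::finite \<times> 'v) \<Rightarrow> real"
  assumes "\<And>M. hist_state E M y = s \<Longrightarrow> h M = a"
  shows "has_bochner_integral (matrix_measure w) (\<lambda>M. h M * indicator (history_cell E y s) M)
      (measure (matrix_measure w) (history_cell E y s) * a)"
proof -
  interpret prob_space "matrix_measure w" by (rule matrix_measure_prob_space)
  have "has_bochner_integral (matrix_measure w) (\<lambda>M. indicator (history_cell E y s) M * a)
      (measure (matrix_measure w) (history_cell E y s) * a)"
    by (intro has_bochner_integral_mult_left has_bochner_integral_real_indicator history_cell_sets)
      (simp add: emeasure_eq_measure)
  moreover have "(\<lambda>M. h M * indicator (history_cell E y s) M) = (\<lambda>M. indicator (history_cell E y s) M * a)"
    using assms by (auto simp: fun_eq_iff history_cell_def split: split_indicator)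
  ultimately show ?thesis by simp
qed

section \<open>Expected reward of a run\<close>

definition covered :: "('v \<times> 'v) set \<Rightarrow> 'v list \<Rightarrow> 'v process_state \<Rightarrow> 'v set" where
  "covered E y s = seeded_set E y (st_obs s)"

definition reward :: "('v \<times> 'v) set \<Rightarrow> ('v::finite \<Rightarrow> real) \<Rightarrow> 'v list \<Rightarrow> 'v process_state \<Rightarrow> real" where
  "reward E r y s = sum r (covered E y s)"

lemma reward_eq_fval: "reward E r y s = fval E r y (st_obs s)"
  by (simp add: reward_def covered_def fval_def)

text \<open>With nothing prescribed, each round of \<open>policy_value\<close> reads a fresh row. By
  \<open>integral_step\<close> this is the law of the next entries given the history.\<close>

lemma run_val_integral:
  fixes w :: "('v::finite \<times> 'v) \<Rightarrow> real"
  shows "has_bochner_integral (matrix_measure w) (\<lambda>M. run_val E r \<pi> n y M * indicator (history_cell E y s) M)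
    (measure (matrix_measure w) (history_cell E y s) * policy_value w (\<lambda>_. None) \<pi> (reward E r) n y s)"
proof (induction n arbitrary: y s)
  case 0
  then show ?case
    by (intro history_cell_const_integral) (simp add: obj_def reward_eq_fval flip: st_obs_hist_state)
next
  case (Suc n)
  show ?case
  proof (cases "(y, st_obs s) \<in> fst \<pi>")
    case False
    then show ?thesis
      by (intro history_cell_const_integral) (auto simp: obj_def reward_eq_fval simp flip: st_obs_hist_state)
  next
    case True
    let ?q = "\<lambda>v. pmf (snd \<pi> (y, st_obs s)) v"
    have "has_bochner_integral (matrix_measure w)
        (\<lambda>M. \<Sum>v\<in>UNIV. ?q v * (run_val E r \<pi> n (y @ [v]) M * indicator (history_cell E y s) M))
        (\<Sum>v\<in>UNIV. ?q v * (measure (matrix_measure w) (history_cell E y s)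
          * live_expectation w (\<lambda>L. policy_value w (\<lambda>_. None) \<pi> (reward E r) n (y @ [v]) (step L v s))))"
      by (intro has_bochner_integral_sum has_bochner_integral_mult_right integral_step Suc.IH)
    moreover have "run_val E r \<pi> (Suc n) y M * indicator (history_cell E y s) M
        = (\<Sum>v\<in>UNIV. ?q v * (run_val E r \<pi> n (y @ [v]) M * indicator (history_cell E y s) M))" for M
    proof (cases "M \<in> history_cell E y s")
      case M: True
      then have "partial E M y = st_obs s" by (auto simp: history_cell_def simp flip: st_obs_hist_state)
      then show ?thesis using M True
        by (simp add: integral_measure_pmf_real[of UNIV] mult.commute)
    qed simp
    ultimately show ?thesis using True
      by (simp add: override_None sum_distrib_left mult_ac)
  qed
qed

lemma run_val_integral_start:
  fixes w :: "('v::finite \<times> 'v) \<Rightarrow> real"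
  shows "(\<integral>M. run_val E r \<pi> n [] M \<partial>matrix_measure w)
    = policy_value w (\<lambda>_. None) \<pi> (reward E r) n [] (E, \<lambda>_. 0, \<lambda>_. None)"
proof -
  interpret prob_space "matrix_measure w" by (rule matrix_measure_prob_space)
  have "history_cell E [] (E, \<lambda>_. 0, \<lambda>_. None) = UNIV" by (simp add: history_cell_def hist_state_Nil)
  then show ?thesis
    using run_val_integral[of w E r \<pi> n "[]" "(E, \<lambda>_. 0, \<lambda>_. None)"] prob_space
    by (simp add: has_bochner_integral_integral_eq space_matrix_measure)
qed

section \<open>Histories of positive probability and their gains\<close>

definition possible_state :: "('v \<times> 'v) set \<Rightarrow> (('v::finite \<times> 'v) \<Rightarrow> real) \<Rightarrow> 'v list \<Rightarrow> 'v process_state \<Rightarrow> bool" where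
  "possible_state E w y s \<longleftrightarrow> 0 < measure (matrix_measure w) (history_cell E y s)"

lemma possible_state_reachable: "possible_state E w y s \<Longrightarrow> \<exists>M. hist_state E M y = s"
  by (cases "history_cell E y s = {}") (auto simp: possible_state_def history_cell_def)

lemma possible_state_Nil: "possible_state E w [] (E, \<lambda>_. 0, \<lambda>_. None)"
proof -
  interpret prob_space "matrix_measure w" by (rule matrix_measure_prob_space)
  have "history_cell E [] (E, \<lambda>_. 0, \<lambda>_. None) = UNIV" by (simp add: history_cell_def hist_state_Nil)
  then show ?thesis using prob_space by (simp add: possible_state_def space_matrix_measure)
qed

lemma possible_state_step:
  assumes "possible_state E w y s" "0 < live_weight w L"
  shows "possible_state E w (y @ [v]) (step L v s)"
proof -
  interpret prob_space "matrix_measure w" by (rule matrix_measure_prob_space)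
  have "history_cell E y s \<noteq> {}" using assms(1) by (auto simp: possible_state_def)
  then have "0 < measure (matrix_measure w) {M \<in> history_cell E y s. next_row M s = L}"
    using assms by (simp add: history_cell_inter_row(2) possible_state_def)
  also have "\<dots> \<le> measure (matrix_measure w) (history_cell E (y @ [v]) (step L v s))"
    by (intro finite_measure_mono history_cell_sets) (auto simp: history_cell_def hist_state_snoc)
  finally show ?thesis by (simp add: possible_state_def)
qed

text \<open>The partial matrix already determines arcs and counts, so conditioning on the history or
  on the state is the same.\<close>

lemma hist_event_eq_history_cell:
  assumes "hist_state E M y = s"
  shows "hist_event E y (st_obs s) = history_cell E y s"
proof -
  have "hist_state E M' y = hist_state E M y" if "partial E M' y = partial E M y" for M'
    using that by (intro hist_state_eqI partial_eq_agrees)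
  then show ?thesis using assms by (auto simp: hist_event_def history_cell_def simp flip: st_obs_hist_state)
qed

definition exp_gain :: "('v \<times> 'v) set \<Rightarrow> ('v::finite \<Rightarrow> real) \<Rightarrow> (('v \<times> 'v) \<Rightarrow> real) \<Rightarrow> 'v list \<Rightarrow> 'v process_state \<Rightarrow> 'v \<Rightarrow> real" where
  "exp_gain E r w y s v = live_expectation w (\<lambda>L. reward E r (y @ [v]) (step L v s)) - reward E r y s"

lemma gain_eq_exp_gain:
  assumes "possible_state E w y s"
  shows "gain E r w v (y, st_obs s) = exp_gain E r w y s v"
proof -
  obtain M where M: "hist_state E M y = s" using assms possible_state_reachable by blast
  have "has_bochner_integral (matrix_measure w)
      (\<lambda>M. obj E r (y @ [v]) M * indicator (history_cell E y s) M)
      (measure (matrix_measure w) (history_cell E y s) * live_expectation w (\<lambda>L. reward E r (y @ [v]) (step L v s)))"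
    by (intro integral_step history_cell_const_integral) (auto simp: obj_def reward_eq_fval simp flip: st_obs_hist_state)
  then show ?thesis using assms
    by (simp add: gain_def exp_gain_def cond_exp_def hist_event_eq_history_cell[OF M] reward_eq_fval
        has_bochner_integral_integral_eq possible_state_def)
qed


section \<open>The coupling\<close>

text \<open>Index \<open>0\<close> is the first observation of an arc.\<close>
definition known :: "'v process_state \<Rightarrow> 'v \<times> 'v \<Rightarrow> bool option" where
  "known s e = st_obs s (e, 0)"

text \<open>The invariant behind the coupling. Its third clause is a barrier: arcs into uncovered
  nodes survive, and those out of covered nodes have been tried, necessarily without
  success.\<close>

definition coherent :: "('v \<times> 'v) set \<Rightarrow> 'v list \<Rightarrow> 'v process_state \<Rightarrow> bool" where
  "coherent E y s \<longleftrightarrow> st_arcs s \<subseteq> E \<and>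
     (\<forall>e j. st_obs s (e, j) \<noteq> None \<longleftrightarrow> j < st_cnt s e) \<and>
     (\<forall>a b. (a, b) \<in> E \<longrightarrow> b \<notin> covered E y s \<longrightarrow>
        (a, b) \<in> st_arcs s \<and> (a \<in> covered E y s \<longrightarrow> 0 < st_cnt s (a, b))) \<and>
     (\<forall>e. 0 < st_cnt s e \<longrightarrow> fst e \<in> covered E y s)"

lemma coherent_arcs: "coherent E y s \<Longrightarrow> st_arcs s \<subseteq> E"
  and coherent_obs_iff: "coherent E y s \<Longrightarrow> st_obs s (e, j) \<noteq> None \<longleftrightarrow> j < st_cnt s e"
  and coherent_out: "coherent E y s \<Longrightarrow> (a, b) \<in> E \<Longrightarrow> b \<notin> covered E y s \<Longrightarrow>
    (a, b) \<in> st_arcs s \<and> (a \<in> covered E y s \<longrightarrow> 0 < st_cnt s (a, b))"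
  and coherent_cnt: "coherent E y s \<Longrightarrow> 0 < st_cnt s e \<Longrightarrow> fst e \<in> covered E y s"
  unfolding coherent_def by blast+

lemma known_eq_None_iff: "coherent E y s \<Longrightarrow> known s e = None \<longleftrightarrow> st_cnt s e = 0"
  using coherent_obs_iff[of E y s e 0] by (auto simp: known_def)

text \<open>A round records successes only on arcs into nodes that it reaches, in any state
  whatsoever. The coupled run uses this inclusion.\<close>

lemma covered_step_subset:
  "covered E (y @ [v]) (step L v s) \<subseteq> covered E y s \<union> reached L (st_arcs s) v"
  by (cases s) (auto simp: covered_def seeded_set_def step_def start_in_reached intro: reached_closed
      split: if_splits)

text \<open>Coherence puts old observations below the counts, where \<open>step\<close> does not
  write, and keeps the traversed arcs inside \<open>E\<close>, as \<open>seeded_set\<close>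
  demands.\<close>

lemma covered_step:
  assumes "coherent E y s"
  shows "covered E (y @ [v]) (step L v s) = covered E y s \<union> reached L (st_arcs s) v"
proof (intro equalityI covered_step_subset subsetI)
  obtain A c P where s: "s = (A, c, P)" by (cases s)
  have A: "A \<subseteq> E" and P: "\<And>e j. P (e, j) \<noteq> None \<longleftrightarrow> j < c e"
    using coherent_arcs[OF assms] coherent_obs_iff[OF assms] by (simp_all add: s)
  fix x assume "x \<in> covered E y s \<union> reached L (st_arcs s) v"
  then show "x \<in> covered E (y @ [v]) (step L v s)"
  proof
    assume "x \<in> covered E y s"
    then consider "x \<in> set y" | u j where "(u, x) \<in> E" "P ((u, x), j) = Some True"
      by (auto simp: covered_def seeded_set_def s)
    then show ?thesis
    proof cases
      case 2
      then have "j < c (u, x)" using P[of "(u, x)" j] by simp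
      then have "st_obs (step L v s) ((u, x), j) = Some True" using 2 by (simp add: s step_def)
      then show ?thesis using 2 by (auto simp: covered_def seeded_set_def)
    qed (auto simp: covered_def seeded_set_def)
  next
    assume "x \<in> reached L (st_arcs s) v"
    then show ?thesis
    proof (induction rule: reached_induct)
      case start
      then show ?case by (simp add: covered_def seeded_set_def)
    next
      case (arc u x)
      then have "st_obs (step L v s) ((u, x), c (u, x)) = Some True" by (simp add: s step_def)
      then show ?case using arc A by (auto simp: covered_def seeded_set_def s)
    qed
  qed
qed

lemma coherent_Nil: "coherent E [] (E, \<lambda>_. 0, \<lambda>_. None)"
  by (simp add: coherent_def covered_def seeded_set_def)

text \<open>For the barrier clause: a node that stays uncovered was not reached, so its incoming
  arcs survive, and a newly reached source has just tried them.\<close>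

lemma coherent_step:
  assumes "coherent E y s"
  shows "coherent E (y @ [v]) (step L v s)"
  unfolding coherent_def covered_step[OF assms]
proof (intro conjI allI impI)
  obtain A c P where s: "s = (A, c, P)" by (cases s)
  have arcs: "A \<subseteq> E" and obs: "\<And>e j. P (e, j) \<noteq> None \<longleftrightarrow> j < c e"
    and out: "\<And>a b. (a, b) \<in> E \<Longrightarrow> b \<notin> covered E y s \<Longrightarrow>
        (a, b) \<in> A \<and> (a \<in> covered E y s \<longrightarrow> 0 < c (a, b))"
    and pos: "\<And>e. 0 < c e \<Longrightarrow> fst e \<in> covered E y s"
    using coherent_arcs[OF assms] coherent_obs_iff[OF assms] coherent_out[OF assms]
      coherent_cnt[OF assms] by (simp_all add: s)
  show "st_arcs (step L v s) \<subseteq> E" using arcs by (auto simp: s step_def)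
  show "(st_obs (step L v s) (e, j) \<noteq> None) = (j < st_cnt (step L v s) e)" for e j
    using obs[of e j] by (auto simp: s step_def less_Suc_eq)
  show "(a, b) \<in> st_arcs (step L v s)"
    if "(a, b) \<in> E" "b \<notin> covered E y s \<union> reached L (st_arcs s) v" for a b
    using that out[of a b] by (auto simp: s step_def)
  show "0 < st_cnt (step L v s) (a, b)"
    if "(a, b) \<in> E" "b \<notin> covered E y s \<union> reached L (st_arcs s) v"
      "a \<in> covered E y s \<union> reached L (st_arcs s) v" for a b
    using that out[of a b] by (auto simp: s step_def)
  show "fst e \<in> covered E y s \<union> reached L (st_arcs s) v" if "0 < st_cnt (step L v s) e" for e
    using that pos[of e] by (auto simp: s step_def split: if_splits)
qed

lemma possible_state_coherent: "possible_state E w y s \<Longrightarrow> coherent E y s"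
proof -
  have "coherent E y (hist_state E M y)" for M
    by (induction y rule: rev_induct) (simp_all add: hist_state_Nil coherent_Nil hist_state_snoc coherent_step)
  then show "possible_state E w y s \<Longrightarrow> coherent E y s" using possible_state_reachable by blast
qed

text \<open>A martingale property. The first observations made in a round reveal a fresh row on a
  stopping set; completing them by an independent row gives a fresh row again.\<close>

lemma policy_value_known_step:
  assumes "coherent E y s"
  shows "live_expectation w (\<lambda>L. policy_value w (known (step L v s)) \<pi> g n y' s') = policy_value w (known s) \<pi> g n y' s'"
proof -
  obtain A c P where s: "s = (A, c, P)" by (cases s)
  define X where "X L = {e. e \<in> A \<and> fst e \<in> reached L A v}" for L
  have P: "P (e, 0) = None \<longleftrightarrow> c e = 0" for e
    using known_eq_None_iff[OF assms, of e] by (simp add: known_def s)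
  have XX: "X ((L \<inter> X L) \<union> (K - X L)) = X L" for L K
  proof -
    have "reached ((L \<inter> X L) \<union> (K - X L)) A v = reached L A v"
      by (rule reached_cong) (auto simp: X_def)
    then show ?thesis unfolding X_def[of "(L \<inter> X L) \<union> (K - X L)"] by (simp only: X_def)
  qed
  have fill: "fill (known s) ((L \<inter> X L) \<union> (K - X L)) = fill (known (step L v s)) K" for L K
  proof
    fix e
    show "fill (known s) ((L \<inter> X L) \<union> (K - X L)) e = fill (known (step L v s)) K e"
      using P[of e] by (cases "c e = 0") (auto simp: fill_def known_def s step_def X_def)
  qed
  have "live_expectation w (\<lambda>L. policy_value w (known (step L v s)) \<pi> g n y' s')
      = live_expectation w (\<lambda>L. live_expectation w (\<lambda>K. policy_value w (fill (known (step L v s)) K) \<pi> g n y' s'))"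
    by (subst policy_value_reveal) (rule refl)
  \<comment> \<open>The exchange is applied to the right-hand side: its row \<open>L\<close> becomes
    \<open>L\<close> on the explored arcs and \<open>K\<close> elsewhere.\<close>
  also have "\<dots> = live_expectation w (\<lambda>L. live_expectation w (\<lambda>K. policy_value w (fill (known s) L) \<pi> g n y' s'))"
    by (subst (2) live_expectation_swap[where X = X]) (simp_all only: XX fill)
  also have "\<dots> = policy_value w (known s) \<pi> g n y' s'"
    by (simp add: live_expectation_const flip: policy_value_reveal)
  finally show ?thesis .
qed

lemma sum_pmf_UNIV: "(\<Sum>v\<in>UNIV. pmf p (v :: 'v::finite)) = 1"
  by (rule sum_pmf_eq_1) auto

text \<open>Iterates the martingale property along a run of \<open>\<pi>\<close>, whatever it seeds
  and whenever it stops. The run of \<open>\<pi>'\<close> keeps its own start \<open>y'\<close>,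
  \<open>s'\<close>, so it is coupled to \<open>\<pi>\<close> rather than appended.\<close>

lemma policy_value_None_known:
  assumes "coherent E y s"
  shows "policy_value w (\<lambda>_. None) \<pi> (\<lambda>y s. policy_value w (known s) \<pi>' g n y' s') i y s
    = policy_value w (known s) \<pi>' g n y' s'"
  using assms
proof (induction i arbitrary: y s)
  case 0
  then show ?case by simp
next
  case (Suc i)
  have "live_expectation w (\<lambda>L. policy_value w (\<lambda>_. None) \<pi> (\<lambda>y s. policy_value w (known s) \<pi>' g n y' s') i (y @ [v]) (step L v s))
      = policy_value w (known s) \<pi>' g n y' s'" for v
    by (simp add: Suc coherent_step policy_value_known_step[OF Suc.prems])
  then show ?case by (simp add: override_None sum_pmf_UNIV flip: sum_distrib_right)
qed

lemma policy_value_None_mono: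
  assumes "\<And>y s. possible_state E w y s \<Longrightarrow> g y s \<le> h y s" and "possible_state E w y s"
  shows "policy_value w (\<lambda>_. None) \<pi> g n y s \<le> policy_value w (\<lambda>_. None) \<pi> h n y s"
  using assms(2)
proof (induction n arbitrary: y s)
  case 0
  then show ?case using assms(1) by simp
next
  case (Suc n)
  have "live_expectation w (\<lambda>L. policy_value w (\<lambda>_. None) \<pi> g n (y @ [v]) (step L v s))
      \<le> live_expectation w (\<lambda>L. policy_value w (\<lambda>_. None) \<pi> h n (y @ [v]) (step L v s))" for v
    by (intro live_expectation_mono Suc.IH possible_state_step Suc.prems)
  then show ?case using assms(1)[OF Suc.prems]
    by (auto simp: override_None intro!: sum_mono mult_left_mono)
qed

lemma policy_value_linear:
  "policy_value w \<kappa> \<pi> (\<lambda>y s. g y s + a * h y s) n y s = policy_value w \<kappa> \<pi> g n y s + a * policy_value w \<kappa> \<pi> h n y s"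
  by (induction n arbitrary: y s)
    (simp_all add: live_expectation_add live_expectation_cmult distrib_left sum.distrib sum_distrib_left mult.left_commute)

text \<open>Splits off the last round instead of the first. A run that stopped earlier meets the
  same history outside the domain and stops again.\<close>

lemma policy_value_Suc_last:
  "policy_value w \<kappa> \<pi> g (Suc n) y s = policy_value w \<kappa> \<pi> (\<lambda>y s. policy_value w \<kappa> \<pi> g (Suc 0) y s) n y s"
proof (induction n arbitrary: y s)
  case 0
  then show ?case by simp
next
  case (Suc n)
  show ?case
  proof (cases "(y, st_obs s) \<in> fst \<pi>")
    case True
    then show ?thesis using Suc.IH by (simp del: policy_value.simps(2) add: policy_value.simps(2)[of _ _ _ _ "Suc n"] policy_value.simps(2)[of _ _ _ "\<lambda>y s. policy_value w \<kappa> \<pi> g (Suc 0) y s"])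
  next
    case False
    then show ?thesis by simp
  qed
qed

section \<open>Bounding a competing policy by the maximal gain\<close>

definition max_gain :: "('v \<times> 'v) set \<Rightarrow> ('v::finite \<Rightarrow> real) \<Rightarrow> (('v \<times> 'v) \<Rightarrow> real) \<Rightarrow> 'v list \<Rightarrow> 'v process_state \<Rightarrow> real" where
  "max_gain E r w y s = Max (range (exp_gain E r w y s))"

lemma exp_gain_le_max_gain: "exp_gain E r w y s v \<le> max_gain E r w y s"
  unfolding max_gain_def by (rule Max_ge) auto

lemma exp_gain_eq:
  assumes "coherent E y s"
  shows "exp_gain E r w y s v = live_expectation w (\<lambda>L. sum r (reached L (st_arcs s) v - covered E y s))"
proof -
  have "sum r (covered E y s \<union> reached L (st_arcs s) v)
      = sum r (covered E y s) + sum r (reached L (st_arcs s) v - covered E y s)" for L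
    by (subst Un_Diff_cancel[symmetric], subst sum.union_disjoint) auto
  then show ?thesis
    by (simp add: exp_gain_def reward_def covered_step[OF assms] live_expectation_add live_expectation_const)
qed

lemma exp_gain_nonneg:
  assumes "coherent E y s" "\<forall>v. 0 \<le> r v"
  shows "0 \<le> exp_gain E r w y s v"
proof -
  have "live_expectation w (\<lambda>L. 0) \<le> exp_gain E r w y s v"
    unfolding exp_gain_eq[OF assms(1)] by (intro live_expectation_mono sum_nonneg) (use assms in blast)
  then show ?thesis by (simp add: live_expectation_const)
qed

lemma max_gain_nonneg:
  assumes "coherent E y s" "\<forall>v. 0 \<le> r v"
  shows "0 \<le> max_gain E r w y s"
  using exp_gain_nonneg[OF assms] exp_gain_le_max_gain order_trans by metis

text \<open>Induction along the coupled diffusion. By the barrier, an arc into an uncovered node is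
  present in \<open>s\<close>. Out of the seed it is drawn from \<open>L\<close>. Out of another
  node it must be unobserved, since an observed one failed; so its source is uncovered too and the
  arc is again drawn from \<open>L\<close>.\<close>

lemma reached_override_known_subset:
  assumes "coherent E y s" "A' \<subseteq> E"
  shows "reached (override (known s) v L) A' v - covered E y s \<subseteq> reached L (st_arcs s) v"
proof -
  have "x \<notin> covered E y s \<longrightarrow> x \<in> reached L (st_arcs s) v" if "x \<in> reached (override (known s) v L) A' v" for x
    using that
  proof (induction rule: reached_induct)
    case start
    then show ?case by (simp add: start_in_reached)
  next
    case (arc u x)
    show ?case
    proof
      assume x: "x \<notin> covered E y s"
      have E: "(u, x) \<in> E" using arc assms(2) by auto
      then have A: "(u, x) \<in> st_arcs s" and c: "u \<in> covered E y s \<Longrightarrow> 0 < st_cnt s (u, x)"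
        using coherent_out[OF assms(1) E x] by auto
      have dom: "known s (u, x) = None \<longleftrightarrow> st_cnt s (u, x) = 0"
        by (rule known_eq_None_iff[OF assms(1)])
      have False: "known s (u, x) \<noteq> Some True"
        using x E by (auto simp: covered_def seeded_set_def known_def)
      show "x \<in> reached L (st_arcs s) v"
      proof (cases "u = v")
        case True
        then show ?thesis using arc(2) A by (auto simp: override_def intro: reached_closed start_in_reached)
      next
        case neq: False
        then have "known s (u, x) = None" using arc(2) False by (auto simp: override_def split: if_splits)
        then have "u \<notin> covered E y s" "(u, x) \<in> L" using c dom arc(2) by (auto simp: override_def)
        then show ?thesis using arc A by (auto intro: reached_closed)
      qed
    qed
  qed
  then show ?thesis by blast
qed

lemma sum_Un_le:
  fixes r :: "'a::finite \<Rightarrow> real"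
  assumes "\<forall>v. 0 \<le> r v"
  shows "sum r (A \<union> B) \<le> sum r A + sum r B"
  using sum.union_inter[of A B r] sum_nonneg[of "A \<inter> B" r] assms by simp

text \<open>Each round of \<open>\<pi>\<close> has a fresh \<open>L\<close> and, outside the set
  covered by \<open>s\<close>, adds at most what its seed would add right after \<open>s\<close>.
  This holds whatever \<open>s'\<close> has become, so every round costs at most one maximal
  gain.\<close>

lemma policy_value_known_le:
  assumes coh: "coherent E y s" and r: "\<forall>v. 0 \<le> r v" and "st_arcs s' \<subseteq> E"
  shows "policy_value w (known s) \<pi> (reward E r) n y' s'
    \<le> sum r (covered E y s \<union> covered E y' s') + real n * max_gain E r w y s"
  using assms(3)
proof (induction n arbitrary: y' s')
  case 0
  then show ?case by (simp add: reward_def) (intro sum_mono2, auto simp: r)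
next
  case (Suc n)
  let ?C = "covered E y s" and ?G = "max_gain E r w y s"
  define B where "B = sum r (?C \<union> covered E y' s')"
  have G: "0 \<le> ?G" by (rule max_gain_nonneg[OF coh r])
  have each: "live_expectation w (\<lambda>L. policy_value w (known s) \<pi> (reward E r) n (y' @ [v]) (step (override (known s) v L) v s'))
      \<le> B + real (Suc n) * ?G" for v
  proof -
    have "policy_value w (known s) \<pi> (reward E r) n (y' @ [v]) (step (override (known s) v L) v s')
        \<le> (B + real n * ?G) + sum r (reached L (st_arcs s) v - ?C)" for L
    proof -
      let ?s = "step (override (known s) v L) v s'"
      have "?C \<union> covered E (y' @ [v]) ?s \<subseteq> (?C \<union> covered E y' s') \<union> (reached L (st_arcs s) v - ?C)"
        using covered_step_subset[of E y' v "override (known s) v L" s']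
          reached_override_known_subset[OF coh Suc.prems, of v L] by blast
      then have "sum r (?C \<union> covered E (y' @ [v]) ?s)
          \<le> sum r ((?C \<union> covered E y' s') \<union> (reached L (st_arcs s) v - ?C))"
        by (intro sum_mono2) (auto simp: r)
      also have "\<dots> \<le> B + sum r (reached L (st_arcs s) v - ?C)"
        unfolding B_def by (rule sum_Un_le[OF r])
      finally have "sum r (?C \<union> covered E (y' @ [v]) ?s) \<le> B + sum r (reached L (st_arcs s) v - ?C)" .
      moreover have "st_arcs ?s \<subseteq> E" using Suc.prems by (auto simp: st_arcs_step)
      ultimately show ?thesis using Suc.IH[of ?s "y' @ [v]"] by linarith
    qed
    then have "live_expectation w (\<lambda>L. policy_value w (known s) \<pi> (reward E r) n (y' @ [v]) (step (override (known s) v L) v s'))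
        \<le> live_expectation w (\<lambda>L. (B + real n * ?G) + sum r (reached L (st_arcs s) v - ?C))"
      by (intro live_expectation_mono)
    \<comment> \<open>Here \<open>L\<close> is explored on the arcs of \<open>s\<close>, so
      averaging yields exactly the gain of \<open>v\<close> after \<open>s\<close>.\<close>
    also have "\<dots> = B + real n * ?G + exp_gain E r w y s v"
      by (simp add: live_expectation_add live_expectation_const exp_gain_eq[OF coh])
    also have "\<dots> \<le> B + real (Suc n) * ?G"
      using exp_gain_le_max_gain[of E r w y s v] by (simp add: algebra_simps)
    finally show ?thesis .
  qed
  show ?case
  proof (cases "(y', st_obs s') \<in> fst \<pi>")
    case True
    let ?q = "pmf (snd \<pi> (y', st_obs s'))"
    have "policy_value w (known s) \<pi> (reward E r) (Suc n) y' s' \<le> (\<Sum>v\<in>UNIV. ?q v * (B + real (Suc n) * ?G))"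
      using True by (simp del: of_nat_Suc) (intro sum_mono mult_left_mono each, simp)
    then show ?thesis by (simp add: B_def sum_pmf_UNIV flip: sum_distrib_right)
  next
    case False
    have "reward E r y' s' \<le> B" unfolding reward_def B_def by (intro sum_mono2) (auto simp: r)
    then show ?thesis using False G by (simp add: B_def add_increasing2)
  qed
qed

text \<open>With probability at least \<open>\<beta>\<close> the gain is at least
  \<open>1 / \<alpha>\<close> of the maximum, and otherwise it is nonnegative. If no gain is
  positive, all vanish, so the policy stops and the maximal gain is zero.\<close>

lemma greedy_step:
  assumes greedy: "approx_greedy E r w \<alpha> \<beta> \<pi>" and r: "\<forall>v. 0 \<le> r v" and \<alpha>: "1 \<le> \<alpha>"
    and possible_state: "possible_state E w y s"
  shows "reward E r y s + \<beta> / \<alpha> * max_gain E r w y s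
    \<le> policy_value w (\<lambda>_. None) \<pi> (reward E r) (Suc 0) y s"
proof -
  let ?h = "(y, st_obs s)" and ?g = "exp_gain E r w y s" and ?G = "max_gain E r w y s"
  note coh = possible_state_coherent[OF possible_state]
  obtain M where M: "hist_state E M y = s" using possible_state possible_state_reachable by blast
  have "possible_hist E w ?h"
    using possible_state by (simp add: possible_hist_def possible_state_def hist_event_eq_history_cell[OF M])
  then have "((\<exists>v. gain E r w v ?h > 0) \<longrightarrow> ?h \<in> fst \<pi> \<and>
        measure_pmf.prob (snd \<pi> ?h)
          {v. gain E r w v ?h \<ge> (1 / \<alpha>) * Max (range (\<lambda>v'. gain E r w v' ?h))} \<ge> \<beta>) \<and>
      ((\<forall>v. gain E r w v ?h = 0) \<longrightarrow> ?h \<notin> fst \<pi>)"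
    using greedy unfolding approx_greedy_def by blast
  then have g1: "(\<exists>v. ?g v > 0) \<Longrightarrow> ?h \<in> fst \<pi> \<and>
        measure_pmf.prob (snd \<pi> ?h) {v. ?g v \<ge> (1 / \<alpha>) * ?G} \<ge> \<beta>"
    and g2: "(\<forall>v. ?g v = 0) \<Longrightarrow> ?h \<notin> fst \<pi>"
    unfolding gain_eq_exp_gain[OF possible_state] max_gain_def by blast+
  show ?thesis
  proof (cases "\<exists>v. ?g v > 0")
    case True
    let ?q = "pmf (snd \<pi> ?h)" and ?S = "{v. ?g v \<ge> (1 / \<alpha>) * ?G}"
    have "\<beta> / \<alpha> * ?G \<le> measure_pmf.prob (snd \<pi> ?h) ?S * (1 / \<alpha> * ?G)"
      using g1[OF True] \<alpha> max_gain_nonneg[OF coh r]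
      by (simp add: divide_right_mono mult_right_mono)
    also have "\<dots> = (\<Sum>v\<in>?S. ?q v * (1 / \<alpha> * ?G))"
      by (simp only: measure_measure_pmf_finite[OF finite] sum_distrib_right)
    also have "\<dots> \<le> (\<Sum>v\<in>?S. ?q v * ?g v)" by (intro sum_mono mult_left_mono) auto
    also have "\<dots> \<le> (\<Sum>v\<in>UNIV. ?q v * ?g v)"
      by (intro sum_mono2) (auto simp: exp_gain_nonneg[OF coh r])
    also have "\<dots> = (\<Sum>v\<in>UNIV. ?q v * live_expectation w (\<lambda>L. reward E r (y @ [v]) (step L v s))) - reward E r y s"
      by (simp add: exp_gain_def right_diff_distrib sum_subtractf sum_pmf_UNIV flip: sum_distrib_right)
    finally show ?thesis using g1[OF True] by (simp add: override_None)
  next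
    case False
    then have 0: "\<forall>v. ?g v = 0" using exp_gain_nonneg[OF coh r] by (metis less_eq_real_def)
    then have "?G = 0" by (simp add: max_gain_def image_constant_conv)
    then show ?thesis using g2[OF 0] by simp
  qed
qed

section \<open>The approximation guarantee\<close>

text \<open>Reduces the supremum in \<open>f_avg\<close> to finitely many run lengths. Once
  \<open>length y\<close> reaches \<open>k\<close>, natural subtraction gives \<open>0\<close>,
  matching the immediate stop.\<close>

lemma run_val_trunc: "run_val E r (trunc \<pi> k) n y M = run_val E r \<pi> (min n (k - length y)) y M"
proof (induction n arbitrary: y)
  case 0
  then show ?case by simp
next
  case (Suc n)
  show ?case
  proof (cases "length y < k")
    case True
    then have "min (Suc n) (k - length y) = Suc (min n (k - length (y @ [v])))" for v :: 'a
      by simp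
    then show ?thesis using True Suc.IH by (simp add: trunc_def)
  next
    case False
    then show ?thesis by (simp add: trunc_def)
  qed
qed

text \<open>Eliminating \<open>G\<close> shows that each step leaves at most the fraction
  \<open>1 - c / k\<close> of the gap to \<open>W\<close>; then \<open>1 + x \<le> exp x\<close> is
  applied.\<close>

lemma greedy_contraction:
  fixes W :: real and F G :: "nat \<Rightarrow> real"
  assumes "\<And>i. W \<le> F i + k * G i" "\<And>i. F i + c * G i \<le> F (Suc i)"
    and "0 < k" "0 \<le> c" "c \<le> k" "F 0 = 0" "0 \<le> W"
  shows "(1 - exp (- (c * real l / k))) * W \<le> F l"
proof -
  have "W - F l \<le> (1 - c / k) ^ l * W"
  proof (induction l)
    case 0
    then show ?case using assms by simp
  next
    case (Suc l)
    have "c / k * (W - F l) \<le> c * G l"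
      using mult_left_mono[of "W - F l" "k * G l" "c / k"] assms(1)[of l] assms(3,4) by simp
    then have "W - F (Suc l) \<le> (1 - c / k) * (W - F l)"
      using assms(2)[of l] by (simp add: algebra_simps)
    also have "\<dots> \<le> (1 - c / k) * ((1 - c / k) ^ l * W)"
      using Suc assms by (intro mult_left_mono) auto
    finally show ?case by simp
  qed
  also have "(1 - c / k) ^ l \<le> exp (- (c / k)) ^ l"
    using exp_ge_add_one_self[of "- (c / k)"] assms by (intro power_mono) auto
  also have "exp (- (c / k)) ^ l = exp (- (c * real l / k))"
    by (simp add: exp_of_nat_mult[symmetric] mult.commute)
  finally show ?thesis using assms by (simp add: algebra_simps mult_right_mono)
qed

theorem theorem3:
  fixes E :: "('v::finite \<times> 'v) set"
    and r :: "'v \<Rightarrow> real"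
    and w :: "('v \<times> 'v) \<Rightarrow> real"
    and \<alpha> \<beta> :: real
    and \<pi> \<pi>' :: "'v policy"
    and l k :: nat
  assumes "\<forall>e\<in>E. 0 \<le> w e \<and> w e \<le> 1"
    and "\<forall>v. 0 \<le> r v"
    and "\<alpha> \<ge> 1" and "0 < \<beta>" and "\<beta> \<le> 1"
    and "approx_greedy E r w \<alpha> \<beta> \<pi>"
    and "0 < l" and "0 < k"
  shows "f_avg E r w (trunc \<pi> l)
           \<ge> (1 - exp (- (\<beta> * real l) / (\<alpha> * real k))) * f_avg E r w (trunc \<pi>' k)"
proof -
  let ?s = "(E, \<lambda>_. 0, \<lambda>_. None) :: 'v process_state"
  let ?X = "\<lambda>g i. policy_value w (\<lambda>_. None) \<pi> g i [] ?s"
  define F where "F i = ?X (reward E r) i" for i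
  define G where "G i = ?X (max_gain E r w) i" for i
  define W where "W n = policy_value w (\<lambda>_. None) \<pi>' (reward E r) n [] ?s" for n
  define \<rho> where "\<rho> = 1 - exp (- (\<beta> * real l) / (\<alpha> * real k))"
  have r: "\<forall>v. 0 \<le> r v" using assms(2) by blast
  have f_avg: "f_avg E r w (trunc p m) = (SUP n. policy_value w (\<lambda>_. None) p (reward E r) (min n m) [] ?s)" for p m
    by (simp add: f_avg_def run_val_trunc run_val_integral_start)
  have policy_value_0: "policy_value w (\<lambda>_. None) p (\<lambda>_ _. 0) n y s = 0" for p n y s
    by (induction n arbitrary: y s) (simp_all add: live_expectation_const)
  have known: "known ?s = (\<lambda>_. None)" by (simp add: known_def fun_eq_iff)
  \<comment> \<open>All lengths up to \<open>k\<close> are treated, because the supremum in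
    \<open>f_avg\<close> runs over \<open>min n k\<close>.\<close>
  have cover: "W n \<le> F i + real k * G i" if "n \<le> k" for n i
  proof -
    \<comment> \<open>Initially nothing is known, so the martingale identity recovers the ordinary
      value of \<open>\<pi>'\<close>.\<close>
    have "W n = ?X (\<lambda>y s. policy_value w (known s) \<pi>' (reward E r) n [] ?s) i"
      by (simp add: policy_value_None_known[OF coherent_Nil] known W_def)
    also have "\<dots> \<le> ?X (\<lambda>y s. reward E r y s + real k * max_gain E r w y s) i"
    proof (rule policy_value_None_mono[OF _ possible_state_Nil])
      fix y s assume "possible_state E w y s"
      note coh = possible_state_coherent[OF this]
      have "policy_value w (known s) \<pi>' (reward E r) n [] ?s \<le> reward E r y s + real n * max_gain E r w y s"
        using policy_value_known_le[OF coh r, of ?s w \<pi>' n "[]"]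
        by (simp add: reward_def covered_def[of E "[]"] seeded_set_def)
      also have "\<dots> \<le> reward E r y s + real k * max_gain E r w y s"
        using that max_gain_nonneg[OF coh r] by (simp add: mult_right_mono)
      finally show "policy_value w (known s) \<pi>' (reward E r) n [] ?s \<le> reward E r y s + real k * max_gain E r w y s" .
    qed
    finally show ?thesis by (simp add: policy_value_linear F_def G_def)
  qed
  have grow: "F i + \<beta> / \<alpha> * G i \<le> F (Suc i)" for i
    unfolding F_def G_def policy_value_linear[symmetric] policy_value_Suc_last[of _ _ _ _ i]
    by (intro policy_value_None_mono[OF _ possible_state_Nil] greedy_step assms r)
  have bound: "\<rho> * W n \<le> F l" if "n \<le> k" for n
  proof -
    have "0 \<le> W n"
      using policy_value_None_mono[OF _ possible_state_Nil, of E w "\<lambda>_ _. 0" "reward E r" \<pi>' n]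
      by (simp add: W_def policy_value_0 reward_def sum_nonneg r)
    moreover have "F 0 = 0" by (simp add: F_def reward_def covered_def seeded_set_def)
    moreover have "\<beta> / \<alpha> \<le> real k"
    proof -
      have "\<beta> / \<alpha> \<le> 1" using assms by (simp add: divide_le_eq)
      then show ?thesis using assms(8) by linarith
    qed
    ultimately have "(1 - exp (- (\<beta> / \<alpha> * real l / real k))) * W n \<le> F l"
      using cover[OF that] grow assms by (intro greedy_contraction[where G = G]) auto
    then show ?thesis by (simp add: \<rho>_def)
  qed
  \<comment> \<open>Positivity allows division by \<open>\<rho>\<close>, so that the bound for each
    length passes to the supremum.\<close>
  have "0 < \<rho>" using assms by (simp add: \<rho>_def)
  then have "f_avg E r w (trunc \<pi>' k) \<le> F l / \<rho>"
    unfolding f_avg using bound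
    by (intro cSUP_least) (auto simp: W_def field_simps)
  moreover have "F l \<le> f_avg E r w (trunc \<pi> l)"
  proof -
    \<comment> \<open>The supremum ranges over finitely many values, hence is bounded above; the
      length \<open>l\<close> attains \<open>F l\<close>.\<close>
    have "finite (range (\<lambda>n. F (min n l)))"
      by (rule finite_subset[of _ "F ` {..l}"]) auto
    then show ?thesis
      unfolding f_avg F_def[symmetric] by (intro cSUP_upper2[of _ _ l]) auto
  qed
  ultimately have "\<rho> * f_avg E r w (trunc \<pi>' k) \<le> f_avg E r w (trunc \<pi> l)"
    using \<open>0 < \<rho>\<close> by (simp add: field_simps)
  then show ?thesis unfolding \<rho>_def .
qed

end
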